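(* With the two-dimensional real algebras defined in the context, $$A_1\cong\mathcal{A}_5\left(\tfrac12,0\right),\qquad A_0^{+}\cong\mathcal{A}_8(0,0),\qquad A_2\cong\mathcal{A}_3\left(\tfrac12,0,\tfrac12\right),$$ and, for every real $t$ with $\sin t,\cos t\in(0,1)$, $$A_{\cos t}^{+}\cong\mathcal{A}_2\left(\tfrac12,0,\tfrac{-\sin t}{2\cos t}\right),\qquad A_{\cos t}^{-}\cong\mathcal{A}_3\left(\tfrac12,0,\tfrac{\sin t}{2\cos t}\right).$$
   Context: All algebras are over $\mathbb{R}$; an algebra is a real vector space with a bilinear product (not assumed associative, commutative or unital), and $\cong$ means there is a linear bijection preserving products. Each of the following is a two-dimensional algebra with basis $e_1,e_2$ and the products indicated. - $A_1$: $e_1e_1=e_1,\ e_1e_2=e_1,\ e_2e_1=e_2,\ e_2e_2=e_2$. - $A_0^{+}$: $e_1e_1=e_2,\ e_1e_2=-e_2,\ e_2e_1=-e_1,\ e_2e_2=e_1$. - $A_2$: $e_1e_1=\frac{\sqrt2}{2}(e_1-e_2),\ e_1e_2=e_2e_1=\frac{\sqrt2}{2}(e_1+e_2),\ e_2e_2=\frac{\sqrt2}{2}(-e_1+e_2)$. - For $c\in(-1,1)\setminus\{0\}$ and $\sigma=\sqrt{1-c^2}$ (for $A_c^{+}$), respectively $\sigma=-\sqrt{1-c^2}$ (for $A_c^{-}$): $e_1e_1=c\,e_1+\sigma e_2,\ e_1e_2=c\,e_1-\sigma e_2,\ e_2e_1=-\sigma e_1+c\,e_2,\ e_2e_2=\sigma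 e_1+c\,e_2$. The algebra $A_{\cos t}^{\pm}$ is $A_c^{\pm}$ with $c=\cos t$. The matrix of structural constants of an algebra with respect to $e_1,e_2$, where $e_ie_j=A^1_{i,j}e_1+A^2_{i,j}e_2$, is $$\begin{pmatrix}A^1_{1,1}&A^1_{1,2}&A^1_{2,1}&A^1_{2,2}\\ A^2_{1,1}&A^2_{1,2}&A^2_{2,1}&A^2_{2,2}\end{pmatrix}.$$ The following algebras (from a known classification of two-dimensional real algebras) are given by their matrices of structural constants: $$\mathcal{A}_2(\alpha_1,\beta_1,\beta_2)=\begin{pmatrix}\alpha_1&0&0&1\\ \beta_1&\beta_2&1-\alpha_1&0\end{pmatrix},\qquad \mathcal{A}_3(\alpha_1,\beta_1,\beta_2)=\begin{pmatrix}\alpha_1&0&0&-1\\ \beta_1&\beta_2&1-\alpha_1&0\end{pmatrix}\qquad(\beta_1\ge0),$$ $$\mathcal{A}_5(\alpha_1,\beta_2)=\begin{pmatrix}\alpha_1&0&0&0\\ 0&\beta_2&1-\alpha_1&0\end{pmatrix},\qquad \mathcal{A}_8(\alpha_1,\beta_1)=\begin{pmatrix}\alpha_1&0&0&-1\\ \beta_1&1-\alpha_1&-\alpha_1&0\end{pmatrix}\quad(\beta_1\ge0\text{ for }\mathcal{A}_8).$$ *)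

theory Defs
  imports "HOL-Analysis.Analysis"
begin

text \<open>
  An algebra is given by its product, a bilinear map on a real vector space; neither
  associativity, commutativity nor a unit is required. The products below are shown to be
  bilinear in \<open>bilinear_table_product\<close> and \<open>bilinear_msc_product\<close>.
\<close>

definition algebra_isomorphic ::
    "('a::real_vector \<Rightarrow> 'a \<Rightarrow> 'a) \<Rightarrow> ('b::real_vector \<Rightarrow> 'b \<Rightarrow> 'b) \<Rightarrow> bool"
    (infix \<open>\<cong>\<close> 50)
  where "m \<cong> m' \<longleftrightarrow> (\<exists>f. linear f \<and> bij f \<and> (\<forall>x y. f (m x y) = m' (f x) (f y)))"

definition e\<^sub>1 :: "real^2" where "e\<^sub>1 = axis 1 1"

definition e\<^sub>2 :: "real^2" where "e\<^sub>2 = axis 2 1"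

text \<open>The bilinear product on the plane whose values \<open>e\<^sub>i e\<^sub>j\<close> are the given vectors \<open>p\<^sub>i\<^sub>j\<close>.\<close>

definition table_product ::
    "real^2 \<Rightarrow> real^2 \<Rightarrow> real^2 \<Rightarrow> real^2 \<Rightarrow> real^2 \<Rightarrow> real^2 \<Rightarrow> real^2"
  where "table_product p11 p12 p21 p22 x y =
    (x$1 * y$1) *\<^sub>R p11 + (x$1 * y$2) *\<^sub>R p12 + (x$2 * y$1) *\<^sub>R p21 + (x$2 * y$2) *\<^sub>R p22"

lemma table_product_basis:
  "table_product p11 p12 p21 p22 e\<^sub>1 e\<^sub>1 = p11"
  "table_product p11 p12 p21 p22 e\<^sub>1 e\<^sub>2 = p12"
  "table_product p11 p12 p21 p22 e\<^sub>2 e\<^sub>1 = p21"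
  "table_product p11 p12 p21 p22 e\<^sub>2 e\<^sub>2 = p22"
  by (simp_all add: table_product_def e\<^sub>1_def e\<^sub>2_def axis_def)

lemma bilinear_table_product: "bilinear (table_product p11 p12 p21 p22)"
  by (auto simp: bilinear_def table_product_def algebra_simps intro!: linearI)

text \<open>
  The columns of a matrix of structural constants are, in order, the coordinates of
  \<open>e\<^sub>1e\<^sub>1\<close>, \<open>e\<^sub>1e\<^sub>2\<close>, \<open>e\<^sub>2e\<^sub>1\<close>, \<open>e\<^sub>2e\<^sub>2\<close>.
\<close>

definition msc_product :: "real^4^2 \<Rightarrow> real^2 \<Rightarrow> real^2 \<Rightarrow> real^2"
  where "msc_product A = table_product (column 1 A) (column 2 A) (column 3 A) (column 4 A)"

lemma bilinear_msc_product: "bilinear (msc_product A)"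
  by (simp add: msc_product_def bilinear_table_product)

lemma msc_product_basis:
  "msc_product A e\<^sub>1 e\<^sub>1 = (A$1$1) *\<^sub>R e\<^sub>1 + (A$2$1) *\<^sub>R e\<^sub>2"
  "msc_product A e\<^sub>1 e\<^sub>2 = (A$1$2) *\<^sub>R e\<^sub>1 + (A$2$2) *\<^sub>R e\<^sub>2"
  "msc_product A e\<^sub>2 e\<^sub>1 = (A$1$3) *\<^sub>R e\<^sub>1 + (A$2$3) *\<^sub>R e\<^sub>2"
  "msc_product A e\<^sub>2 e\<^sub>2 = (A$1$4) *\<^sub>R e\<^sub>1 + (A$2$4) *\<^sub>R e\<^sub>2"
  unfolding msc_product_def table_product_basis
  by (simp_all add: vec_eq_iff forall_2 column_def e\<^sub>1_def e\<^sub>2_def axis_def)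

definition A\<^sub>1 :: "real^2 \<Rightarrow> real^2 \<Rightarrow> real^2"
  where "A\<^sub>1 = table_product e\<^sub>1 e\<^sub>1 e\<^sub>2 e\<^sub>2"

definition A\<^sub>0_plus :: "real^2 \<Rightarrow> real^2 \<Rightarrow> real^2"
  where "A\<^sub>0_plus = table_product e\<^sub>2 (- e\<^sub>2) (- e\<^sub>1) e\<^sub>1"

definition A\<^sub>2 :: "real^2 \<Rightarrow> real^2 \<Rightarrow> real^2"
  where "A\<^sub>2 = table_product
    ((sqrt 2 / 2) *\<^sub>R (e\<^sub>1 - e\<^sub>2)) ((sqrt 2 / 2) *\<^sub>R (e\<^sub>1 + e\<^sub>2))
    ((sqrt 2 / 2) *\<^sub>R (e\<^sub>1 + e\<^sub>2)) ((sqrt 2 / 2) *\<^sub>R (- e\<^sub>1 + e\<^sub>2))"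

definition A_product :: "real \<Rightarrow> real \<Rightarrow> real^2 \<Rightarrow> real^2 \<Rightarrow> real^2"
  where "A_product c \<sigma> = table_product
    (c *\<^sub>R e\<^sub>1 + \<sigma> *\<^sub>R e\<^sub>2) (c *\<^sub>R e\<^sub>1 - \<sigma> *\<^sub>R e\<^sub>2)
    (- \<sigma> *\<^sub>R e\<^sub>1 + c *\<^sub>R e\<^sub>2) (\<sigma> *\<^sub>R e\<^sub>1 + c *\<^sub>R e\<^sub>2)"

text \<open>The next two are meant only for \<open>c\<close> in \<open>(-1, 1)\<close> with \<open>c \<noteq> 0\<close>.\<close>

definition A_plus :: "real \<Rightarrow> real^2 \<Rightarrow> real^2 \<Rightarrow> real^2"
  where "A_plus c = A_product c (sqrt (1 - c\<^sup>2))"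

definition A_minus :: "real \<Rightarrow> real^2 \<Rightarrow> real^2 \<Rightarrow> real^2"
  where "A_minus c = A_product c (- sqrt (1 - c\<^sup>2))"

text \<open>The families \<open>\<A>\<^sub>3\<close> and \<open>\<A>\<^sub>8\<close> are meant only for \<open>\<beta>\<^sub>1 \<ge> 0\<close>.\<close>

definition \<A>\<^sub>2 :: "real \<Rightarrow> real \<Rightarrow> real \<Rightarrow> real^2 \<Rightarrow> real^2 \<Rightarrow> real^2"
  where "\<A>\<^sub>2 \<alpha>\<^sub>1 \<beta>\<^sub>1 \<beta>\<^sub>2 = msc_product (vector [
    vector [\<alpha>\<^sub>1, 0, 0, 1],
    vector [\<beta>\<^sub>1, \<beta>\<^sub>2, 1 - \<alpha>\<^sub>1, 0]])"

definition \<A>\<^sub>3 :: "real \<Rightarrow> real \<Rightarrow> real \<Rightarrow> real^2 \<Rightarrow> real^2 \<Rightarrow> real^2"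
  where "\<A>\<^sub>3 \<alpha>\<^sub>1 \<beta>\<^sub>1 \<beta>\<^sub>2 = msc_product (vector [
    vector [\<alpha>\<^sub>1, 0, 0, -1],
    vector [\<beta>\<^sub>1, \<beta>\<^sub>2, 1 - \<alpha>\<^sub>1, 0]])"

definition \<A>\<^sub>5 :: "real \<Rightarrow> real \<Rightarrow> real^2 \<Rightarrow> real^2 \<Rightarrow> real^2"
  where "\<A>\<^sub>5 \<alpha>\<^sub>1 \<beta>\<^sub>2 = msc_product (vector [
    vector [\<alpha>\<^sub>1, 0, 0, 0],
    vector [0, \<beta>\<^sub>2, 1 - \<alpha>\<^sub>1, 0]])"

definition \<A>\<^sub>8 :: "real \<Rightarrow> real \<Rightarrow> real^2 \<Rightarrow> real^2 \<Rightarrow> real^2"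
  where "\<A>\<^sub>8 \<alpha>\<^sub>1 \<beta>\<^sub>1 = msc_product (vector [
    vector [\<alpha>\<^sub>1, 0, 0, -1],
    vector [\<beta>\<^sub>1, 1 - \<alpha>\<^sub>1, - \<alpha>\<^sub>1, 0]])"

end

theory Submission
  imports Defs
begin

text \<open>
  In \<open>A\<^sub>1\<close>, \<open>A\<^sub>0\<^sup>+\<close> and \<open>A\<^sub>c\<^sup>\<plusminus>\<close> the right multiplication by \<open>y\<close> is a combination
  of the identity and the rotation \<open>J\<close> by a right angle: it is
  \<open>(y\<^sub>1 + y\<^sub>2) I\<close>, \<open>(y\<^sub>1 - y\<^sub>2) J\<close> and \<open>c (y\<^sub>1 + y\<^sub>2) I + \<sigma> (y\<^sub>1 - y\<^sub>2) J\<close> respectively.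
  In the target algebras it is similarly governed by the coordinates of \<open>y\<close>, so comparing the
  two linear forms in \<open>y\<close> determines the rows of the isomorphism up to scaling.
  In complex notation \<open>A\<^sub>2\<close> has the product \<open>\<omega> z w\<close> with \<open>\<omega> = exp (-\<i>\<pi>/4)\<close>, and
  \<open>\<A>\<^sub>3 (1/2) 0 (1/2)\<close> has the product \<open>z w / 2\<close> after scaling the second coordinate by
  \<open>sqrt 2\<close>; multiplication by \<open>2 \<omega>\<close> intertwines the two.
\<close>

lemma algebra_isomorphic_matrixI:
  fixes M :: "real^'n^'n"
  assumes "det M \<noteq> 0" and "\<And>x y. M *v m x y = m' (M *v x) (M *v y)"
  shows "m \<cong> m'"
  unfolding algebra_isomorphic_def
  using assms invertible_det_nz[of M] invertible_eq_bij[of M]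
  by (blast intro: matrix_vector_mul_linear)

lemma vector_4_nth:
  fixes a b c d :: "'a::zero"
  shows "(vector [a, b, c, d] :: 'a^4) $ 1 = a" "(vector [a, b, c, d] :: 'a^4) $ 2 = b"
    "(vector [a, b, c, d] :: 'a^4) $ 3 = c" "(vector [a, b, c, d] :: 'a^4) $ 4 = d"
  by (simp_all add: vector_def)

lemmas coordinate_simps = vec_eq_iff forall_2 matrix_vector_mult_def sum_2 det_2
  table_product_def msc_product_def column_def e\<^sub>1_def e\<^sub>2_def axis_def vector_4_nth

lemma A\<^sub>1_iso: "A\<^sub>1 \<cong> \<A>\<^sub>5 (1/2) 0"
  \<comment> \<open>The target product is (Y_1/2) X, which forces the first row; the second is any
    independent one.\<close>
  by (rule algebra_isomorphic_matrixI[where M = "vector [vector [2, 2], vector [0, 1]]"])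
    (simp_all add: A\<^sub>1_def \<A>\<^sub>5_def coordinate_simps algebra_simps)

lemma A\<^sub>0_plus_iso: "A\<^sub>0_plus \<cong> \<A>\<^sub>8 0 0"
  \<comment> \<open>The target product is Y_2 J X: the second row must be y_1 - y_2, and commuting
    with J fixes the first.\<close>
  by (rule algebra_isomorphic_matrixI[where M = "vector [vector [-1, -1], vector [1, -1]]"])
    (simp_all add: A\<^sub>0_plus_def \<A>\<^sub>8_def coordinate_simps algebra_simps)

lemma A\<^sub>2_iso: "A\<^sub>2 \<cong> \<A>\<^sub>3 (1/2) 0 (1/2)"
proof -
  have sqrt2: "sqrt 2 * (sqrt 2 * z) = 2 * z" for z :: real
    by (simp flip: mult.assoc)
  show ?thesis
    by (rule algebra_isomorphic_matrixI[where M = "vector [vector [sqrt 2, sqrt 2], vector [-1, 1]]"])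
      (simp_all add: A\<^sub>2_def \<A>\<^sub>3_def coordinate_simps field_simps sqrt2)
qed

lemma A_product_iso:
  assumes "c \<noteq> 0" "k \<noteq> 0" and k: "\<epsilon> * k\<^sup>2 = 2 * c * \<sigma>"
  shows "A_product c \<sigma> \<cong> msc_product (vector [
    vector [1/2, 0, 0, \<epsilon>],
    vector [0, - \<sigma> / (2 * c), 1 - 1/2, 0]])" (is "_ \<cong> ?m")
proof (rule algebra_isomorphic_matrixI)
  let ?M = "vector [vector [2 * c, 2 * c], vector [k, - k]] :: real^2^2"
  show "det ?M \<noteq> 0"
    using assms by (simp add: det_2)
  show "?M *v A_product c \<sigma> x y = ?m (?M *v x) (?M *v y)" for x y
  proof -
    \<comment> \<open>In the first coordinate \<open>?q\<close> has coefficient 2 c \<sigma> on the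
      left and \<epsilon> k^2 on the right.\<close>
    let ?q = "(x$1 - x$2) * (y$1 - y$2)"
    have "\<epsilon> * k\<^sup>2 * ?q = 2 * c * \<sigma> * ?q"
      using k by simp
    then show ?thesis
      using \<open>c \<noteq> 0\<close>
      by (simp add: A_product_def coordinate_simps field_simps power2_eq_square)
  qed
qed

lemma A_plus_iso:
  assumes "0 < s" "0 < c" "s\<^sup>2 + c\<^sup>2 = 1"
  shows "A_plus c \<cong> \<A>\<^sub>2 (1/2) 0 (- s / (2 * c))"
proof -
  have "sqrt (1 - c\<^sup>2) = s"
    using assms by (intro real_sqrt_unique) (auto simp: algebra_simps)
  then show ?thesis
    using A_product_iso[of c "sqrt (2 * c * s)" 1 s] assms
    by (simp add: A_plus_def \<A>\<^sub>2_def)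
qed

lemma A_minus_iso:
  assumes "0 < s" "0 < c" "s\<^sup>2 + c\<^sup>2 = 1"
  shows "A_minus c \<cong> \<A>\<^sub>3 (1/2) 0 (s / (2 * c))"
proof -
  have "sqrt (1 - c\<^sup>2) = s"
    using assms by (intro real_sqrt_unique) (auto simp: algebra_simps)
  then show ?thesis
    \<comment> \<open>Since c \<sigma> < 0 here, a real \<open>k\<close> needs \<epsilon> < 0: this
      sign separates \<open>\<A>\<^sub>3\<close> from \<open>\<A>\<^sub>2\<close>.\<close>
    using A_product_iso[of c "sqrt (2 * c * s)" "-1" "- s"] assms
    by (simp add: A_minus_def \<A>\<^sub>3_def)
qed

theorem theorem4:
  "A\<^sub>1 \<cong> \<A>\<^sub>5 (1/2) 0 \<and>
   A\<^sub>0_plus \<cong> \<A>\<^sub>8 0 0 \<and>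
   A\<^sub>2 \<cong> \<A>\<^sub>3 (1/2) 0 (1/2) \<and>
   (\<forall>t::real. sin t \<in> {0<..<1} \<and> cos t \<in> {0<..<1} \<longrightarrow>
      A_plus (cos t) \<cong> \<A>\<^sub>2 (1/2) 0 (- sin t / (2 * cos t)) \<and>
      A_minus (cos t) \<cong> \<A>\<^sub>3 (1/2) 0 (sin t / (2 * cos t)))"
  by (intro conjI allI impI A\<^sub>1_iso A\<^sub>0_plus_iso A\<^sub>2_iso A_plus_iso A_minus_iso) simp_all

end
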